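(* Let $N\ge 1$ and consider the leader-follower system on the $N\times N$ 2D directed lattice, $\dot{\mathbf{x}} = -L_2 \mathbf{x} + d$, where $L_2 \in \mathbb{R}^{N^2\times N^2}$ is the lower triangular block Toeplitz matrix, with $N\times N$ blocks, having $K_2$ on the main block diagonal, $-I$ on the first block subdiagonal and $0$ in every other block, and where $K_2 \in \mathbb{R}^{N\times N}$ is the lower triangular Toeplitz matrix with $2$ on the main diagonal, $-1$ on the first subdiagonal, and $0$ everywhere else. Let $P = \int_0^\infty e^{-L_2 t} e^{-L_2^T t}\,dt \in \mathbb{R}^{N^2\times N^2}$ be the steady-state covariance matrix, let $P_n \in \mathbb{R}^{N\times N}$ be the $n$th diagonal block of $P$, and let $(P_n)_m$ be the $m$th diagonal element of $P_n$. Then the steady-state variance of the follower at the $n$th row and $m$th column is $$(P_n)_m = \sum_{i=1}^n \sum_{j=1}^m \frac{(2i+2j-4)!}{4\cdot 4^{2i+2j-4}\,\bigl((i-1)!\,(j-1)!\bigr)^2}, \qquad n,m = 1,\ldots,N.$$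
   Context: The 2D leader-follower system has followers indexed by $(n,m)$, $1\le n,m\le N$ (row $n$, column $m$), with scalar states obeying $\dot{x}_{n,m} = -(x_{n,m}-x_{n,m-1}) - (x_{n,m}-x_{n-1,m}) + d_{n,m}$, with boundary values $x_{n,0} = x_{0,m} = x_0 \equiv 0$ (the leader's state). Stacking rows, $\mathbf{x} = [\mathbf{x}_1^T \cdots \mathbf{x}_N^T]^T$ with $\mathbf{x}_n = [x_{n,1} \cdots x_{n,N}]^T$, gives $\dot{\mathbf{x}} = -L_2\mathbf{x}+d$ with $L_2$ as in the claim. The disturbance $d$ is zero-mean, unit-variance white noise, uncorrelated across followers (identity intensity matrix), so the steady-state covariance $\lim_{t\to\infty}E\{\mathbf{x}(t)\mathbf{x}^T(t)\}$ equals $P = \int_0^\infty e^{-L_2 t} e^{-L_2^T t}\,dt$. The steady-state variance of follower $(n,m)$ is the corresponding diagonal entry $(P_n)_m$ of $P$. *)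

theory Defs
  imports
    "HOL-Analysis.Henstock_Kurzweil_Integration"
    "Jordan_Normal_Form.Matrix"
begin

text \<open>
  Matrices are those of \<^theory>\<open>Jordan_Normal_Form.Matrix\<close>, whose indices start at \<open>0\<close>.  The
  mathematical indices \<open>n, m\<close> of followers and of diagonal blocks run from \<open>1\<close> to \<open>N\<close>; follower
  \<open>(n, m)\<close> is component \<open>(n - 1) * N + (m - 1)\<close> of the stacked state vector.
\<close>

definition K2 :: "nat \<Rightarrow> real mat" where
  "K2 N = mat N N (\<lambda>(i, j). if i = j then 2 else if i = j + 1 then - 1 else 0)"

definition block_matrix :: "nat \<Rightarrow> (nat \<Rightarrow> nat \<Rightarrow> real mat) \<Rightarrow> real mat" where
  "block_matrix N B = mat (N * N) (N * N) (\<lambda>(r, c). B (r div N) (c div N) $$ (r mod N, c mod N))"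

definition L2 :: "nat \<Rightarrow> real mat" where
  "L2 N = block_matrix N
     (\<lambda>i j. if i = j then K2 N else if i = j + 1 then - 1\<^sub>m N else 0\<^sub>m N N)"

definition diag_block :: "nat \<Rightarrow> real mat \<Rightarrow> nat \<Rightarrow> real mat" where
  "diag_block N P n = mat N N (\<lambda>(i, j). P $$ ((n - 1) * N + i, (n - 1) * N + j))"

definition diag_elem :: "real mat \<Rightarrow> nat \<Rightarrow> real" where
  "diag_elem A m = A $$ (m - 1, m - 1)"

text \<open>The exponential series of a square matrix, summed entrywise.\<close>

definition mat_exp :: "real mat \<Rightarrow> real mat" where
  "mat_exp A = mat (dim_row A) (dim_row A) (\<lambda>(i, j). \<Sum>k. (A ^\<^sub>m k) $$ (i, j) / fact k)"

text \<open>
  \<open>\<integral>\<^sub>0\<^sup>\<infinity> e\<^bsup>-At\<^esup> e\<^bsup>-A\<^sup>Tt\<^esup> dt\<close>, taken entrywise: the steady-state covariance of \<open>x' = -A x + d\<close> for white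
  noise \<open>d\<close> with identity intensity matrix.
\<close>

definition steady_state_cov :: "real mat \<Rightarrow> real mat" where
  "steady_state_cov A = mat (dim_row A) (dim_row A)
     (\<lambda>(i, j). integral {0..}
        (\<lambda>t. (mat_exp (t \<cdot>\<^sub>m (- A)) * mat_exp (t \<cdot>\<^sub>m (- transpose_mat A))) $$ (i, j)))"

lemma L2_index:
  assumes "a < N" "b < N" "c < N * N"
  shows "L2 N $$ (a * N + b, c) =
    (if c = a * N + b then 2 else 0) +
    (if 0 < b \<and> c = a * N + (b - 1) then - 1 else 0) +
    (if 0 < a \<and> c = (a - 1) * N + b then - 1 else 0)"
proof -
  have N: "0 < N" using assms(1) by simp
  have cd: "c div N < N" using assms(3) by (simp add: less_mult_imp_div_less)
  have cm: "c mod N < N" using N by simp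
  have r: "a * N + b < N * N"
  proof -
    have "a * N + b < (a + 1) * N" using assms(2) by simp
    also have "\<dots> \<le> N * N" using assms(1) by (intro mult_right_mono) auto
    finally show ?thesis .
  qed
  have eq: "c = u * N + v \<longleftrightarrow> c div N = u \<and> c mod N = v" if "v < N" for u v
    using that by (metis N div_mult_mod_eq mod_mult_self3 mod_less div_mult_self3
        add.commute div_less add_0_right less_nat_zero_code)
  have 1: "(a * N + b) div N = a" "(a * N + b) mod N = b" using assms(2) by auto
  have b1: "b - 1 < N" using assms(2) by simp
  show ?thesis
    unfolding L2_def block_matrix_def eq[OF assms(2)] eq[OF b1]
    using assms r cd cm 1
    by (auto simp: K2_def)
qed

text \<open>
  \<open>- L2 N\<close> is the system matrix of the follower dynamics, with the leader in row \<open>0\<close> and column \<open>0\<close>.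
\<close>

lemma L2_dynamics:
  fixes x :: "nat \<Rightarrow> nat \<Rightarrow> real"
  assumes "1 \<le> n" "n \<le> N" "1 \<le> m" "m \<le> N"
    and leader: "\<And>k. x k 0 = 0" "\<And>k. x 0 k = 0"
  shows "(- L2 N *\<^sub>v vec (N * N) (\<lambda>r. x (r div N + 1) (r mod N + 1))) $ ((n - 1) * N + (m - 1)) =
    - (x n m - x n (m - 1)) - (x n m - x (n - 1) m)"
proof -
  obtain a b where ab: "n = a + 1" "m = b + 1" using assms(1,3) by (metis add.commute le_Suc_ex)
  have a: "a < N" and b: "b < N" using ab assms by auto
  define y where "y = (\<lambda>r. x (r div N + 1) (r mod N + 1))"
  let ?r = "a * N + b"
  have lt: "u * N + v < N * N" if "u < N" "v < N" for u v
  proof -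
    have "u * N + v < (u + 1) * N" using that by simp
    also have "\<dots> \<le> N * N" using that by (intro mult_right_mono) auto
    finally show ?thesis .
  qed
  have y_eq: "y (u * N + v) = x (u + 1) (v + 1)" if "v < N" for u v
    using that by (simp add: y_def)
  have a1: "a - 1 < N" and b1: "b - 1 < N" using a b by simp_all
  have "(- L2 N *\<^sub>v vec (N * N) y) $ ?r = (\<Sum>c<N * N. - (L2 N $$ (?r, c)) * y c)"
    using lt[OF a b]
    by (auto simp: scalar_prod_def L2_def block_matrix_def atLeast0LessThan sum_negf)
  also have "\<dots> = (\<Sum>c<N * N. (if c = ?r then - 2 * y c else 0) +
      (if c = a * N + (b - 1) then (if 0 < b then y c else 0) else 0) +
      (if c = (a - 1) * N + b then (if 0 < a then y c else 0) else 0))"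
    using a b by (intro sum.cong) (auto simp: L2_index)
  also have "\<dots> = - 2 * y ?r + (if 0 < b then y (a * N + (b - 1)) else 0) +
      (if 0 < a then y ((a - 1) * N + b) else 0)"
    by (simp only: sum.distrib sum.delta[OF finite_lessThan] lessThan_iff if_True
        lt[OF a b] lt[OF a b1] lt[OF a1 b])
  also have "\<dots> = - 2 * x n m + x n (m - 1) + x (n - 1) m"
    unfolding y_eq[OF b] y_eq[OF b1] using leader ab by (cases a; cases b) auto
  finally show ?thesis using ab by (simp add: y_def)
qed

end

theory Submission
  imports Defs "HOL-Probability.Distributions"
begin

text \<open>
  The system matrix of the lattice is \<open>- L\<^sub>2 = - 2I + S + T\<close>, where the nilpotent matrices \<open>S\<close> and
  \<open>T\<close> shift the lattice by one row and by one column.  The three summands commute, so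
  \<open>e\<^bsup>-L\<^sub>2t\<^esup> = e\<^bsup>-2t\<^esup> e\<^bsup>tS\<^esup> e\<^bsup>tT\<^esup>\<close>, and the entry of this matrix between the nodes \<open>(n, m)\<close> and
  \<open>(c, d)\<close> is \<open>e\<^bsup>-2t\<^esup> (t\<^bsup>n-c\<^esup> / (n - c)!) (t\<^bsup>m-d\<^esup> / (m - d)!)\<close> when \<open>c \<le> n\<close> and \<open>d \<le> m\<close>, and \<open>0\<close>
  otherwise (lemma \<open>mat_exp_L2_entry\<close>).  The exponential of the transposed matrix is the transpose,
  so a diagonal entry of \<open>e\<^bsup>-L\<^sub>2t\<^esup> e\<^bsup>-L\<^sub>2\<^sup>Tt\<^esup>\<close> is a sum of squares of such entries.  With
  \<open>i = n - c + 1\<close> and \<open>j = m - d + 1\<close>, each square is \<open>t\<^bsup>2i+2j-4\<^esup> e\<^bsup>-4t\<^esup>\<close> divided by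
  \<open>((i - 1)! (j - 1)!)\<^sup>2\<close>, and \<open>\<integral>\<^sub>0\<^sup>\<infinity> t\<^sup>k e\<^bsup>-4t\<^esup> dt = k! / 4\<^bsup>k+1\<^esup>\<close> gives the claim.

  The entry formula is obtained from the powers of \<open>- t L\<^sub>2\<close> (lemma \<open>pow_L2_entry\<close>), by induction on
  the exponent: a column of a power, read as a state of the followers with the leader at \<open>0\<close>, is
  multiplied by \<open>- L\<^sub>2\<close> according to the follower dynamics.  Divided powers with integer exponents,
  zero for negative ones, make the recurrence hold on the boundary of the lattice as well.
\<close>

section \<open>Divided powers\<close>

text \<open>
  The divided power \<open>x\<^sup>j / j!\<close> for an integer \<open>j\<close>, with value \<open>0\<close> for \<open>j < 0\<close>.  This is the convention
  under which \<open>j (x\<^sup>j / j!) = x (x\<^bsup>j-1\<^esup> / (j - 1)!)\<close> holds for all \<open>j\<close>, including \<open>j \<le> 0\<close>.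
\<close>

definition dpow :: "real \<Rightarrow> int \<Rightarrow> real" where
  "dpow x j = (if j < 0 then 0 else x ^ nat j / fact (nat j))"

lemma dpow_neg [simp]: "j < 0 \<Longrightarrow> dpow x j = 0"
  by (simp add: dpow_def)

lemma dpow_of_nat [simp]: "dpow x (int j) = x ^ j / fact j"
  by (simp add: dpow_def)

lemma dpow_rec: "of_int j * dpow x j = x * dpow x (j - 1)"
proof (cases "j \<ge> 1")
  case True
  then have "j = int (Suc (nat (j - 1)))" by simp
  then obtain i where j: "j = int (Suc i)" by blast
  have "of_int j * dpow x j = real (Suc i) * (x ^ Suc i / (real (Suc i) * fact i))"
    by (simp only: j dpow_of_nat fact_Suc of_int_of_nat_eq)
  also have "\<dots> = x * (x ^ i / fact i)"
    by (simp del: of_nat_Suc)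
  also have "x ^ i / fact i = dpow x (j - 1)"
    by (simp add: j)
  finally show ?thesis .
next
  case False
  then consider "j = 0" | "j < 0" by linarith
  then show ?thesis by cases simp_all
qed

lemma dpow_sums_exp:
  assumes "0 \<le> s"
  shows "(\<lambda>k. dpow x (int k - s)) sums exp x"
proof -
  obtain r where r: "s = int r" using assms nonneg_int_cases by blast
  have "(\<lambda>k. dpow x (int (k + r) - s)) sums exp x"
    using exp_converges[of x] by (simp add: r divide_inverse mult.commute)
  then show ?thesis
    by (subst (asm) sums_zero_iff_shift) (simp_all add: r)
qed

section \<open>Powers and exponentials of transposed matrices\<close>

lemma pow_mat_Suc_left:
  fixes A :: "'a::semiring_1 mat"
  assumes A: "A \<in> carrier_mat n n"
  shows "A ^\<^sub>m Suc k = A * A ^\<^sub>m k"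
proof (induction k)
  case 0
  then show ?case using A by simp
next
  case (Suc k)
  have "A ^\<^sub>m Suc (Suc k) = (A * A ^\<^sub>m k) * A"
    using Suc by simp
  also have "\<dots> = A * A ^\<^sub>m Suc k"
    using A by (simp add: assoc_mult_mat[of _ n n _ n _ n])
  finally show ?case .
qed

lemma transpose_pow_mat:
  fixes A :: "'a::comm_semiring_1 mat"
  assumes A: "A \<in> carrier_mat n n"
  shows "transpose_mat A ^\<^sub>m k = transpose_mat (A ^\<^sub>m k)"
proof (induction k)
  case 0
  then show ?case using A by simp
next
  case (Suc k)
  have "transpose_mat A ^\<^sub>m Suc k = transpose_mat (A ^\<^sub>m k) * transpose_mat A"
    using Suc by simp
  also have "\<dots> = transpose_mat (A * A ^\<^sub>m k)"
    using A by (simp add: transpose_mult[of _ n n _ n])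
  also have "\<dots> = transpose_mat (A ^\<^sub>m Suc k)"
    using pow_mat_Suc_left[OF A] by simp
  finally show ?case .
qed

lemma mat_exp_transpose:
  assumes A: "A \<in> carrier_mat n n"
  shows "mat_exp (transpose_mat A) = transpose_mat (mat_exp A)"
  using A by (intro eq_matI) (simp_all add: mat_exp_def transpose_pow_mat[OF A])

section \<open>The exponential of the system matrix\<close>

lemma dim_L2 [simp]: "dim_row (L2 N) = N * N" "dim_col (L2 N) = N * N"
  by (simp_all add: L2_def block_matrix_def)

lemma L2_carrier: "L2 N \<in> carrier_mat (N * N) (N * N)"
  by (simp add: L2_def block_matrix_def)

lemma node_less:
  assumes "1 \<le> n" "n \<le> N" "1 \<le> m" "m \<le> (N::nat)"
  shows "(n - 1) * N + (m - 1) < N * N"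
proof -
  have "(n - 1) * N + (m - 1) < (n - 1) * N + N" using assms by simp
  also have "\<dots> = n * N" using assms by (simp add: algebra_simps flip: mult_Suc)
  also have "\<dots> \<le> N * N" using assms by simp
  finally show ?thesis .
qed

lemma node_eq_iff:
  assumes "1 \<le> n" "1 \<le> m" "m \<le> N" "1 \<le> c" "1 \<le> d" "d \<le> (N::nat)"
  shows "(n - 1) * N + (m - 1) = (c - 1) * N + (d - 1) \<longleftrightarrow> n = c \<and> m = d"
proof
  assume eq: "(n - 1) * N + (m - 1) = (c - 1) * N + (d - 1)"
  have divmod: "(u * N + v) div N = u" "(u * N + v) mod N = v" if "v < N" for u v
    using that by simp_all
  have "m - 1 < N" "d - 1 < N" using assms by simp_all
  from divmod[OF this(1), of "n - 1"] divmod[OF this(2), of "c - 1"]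
  have "n - 1 = c - 1" "m - 1 = d - 1" unfolding eq by metis+
  then show "n = c \<and> m = d" using assms by linarith
qed simp

text \<open>
  With \<open>p = n - c\<close> and \<open>q = m - d\<close>, the right-hand side is the coefficient, powers of \<open>- 2t\<close> and \<open>t\<close>
  included, of \<open>S\<^sup>p T\<^sup>q\<close> in the multinomial expansion of \<open>(- 2t I + t S + t T)\<^sup>k\<close>; it is \<open>0\<close> when \<open>p\<close> or
  \<open>q\<close> is negative, or when \<open>p + q > k\<close>.
\<close>

lemma pow_L2_entry:
  fixes t :: real
  assumes "1 \<le> n" "n \<le> N" "1 \<le> m" "m \<le> N" and c: "1 \<le> c" "c \<le> N" and d: "1 \<le> d" "d \<le> N"
  shows "((t \<cdot>\<^sub>m (- L2 N)) ^\<^sub>m k) $$ ((n - 1) * N + (m - 1), (c - 1) * N + (d - 1)) =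
    fact k * (dpow (- 2 * t) (int k - (int n - int c) - (int m - int d))
      * dpow t (int n - int c) * dpow t (int m - int d))"
  using assms(1-4)
proof (induction k arbitrary: n m)
  case 0
  have "dpow (- 2 * t) (- (int n - int c) - (int m - int d))
      * dpow t (int n - int c) * dpow t (int m - int d) = (if n = c \<and> m = d then 1 else 0)"
    by (cases "n < c"; cases "m < d"; cases "n = c \<and> m = d") (auto simp: dpow_def)
  then show ?case
    using 0 c d node_less[of n N m] node_less[of c N d] node_eq_iff[of n m N c d]
      L2_carrier[of N] by simp
next
  case (Suc k)
  let ?B = "t \<cdot>\<^sub>m (- L2 N)"
  let ?j = "(c - 1) * N + (d - 1)"
  define W where "W k p q = dpow (- 2 * t) (int k - p - q) * dpow t p * dpow t q" for k p q
  have W_rec: "of_nat (Suc k) * W (Suc k) p q =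
      t * (W k p (q - 1) + W k (p - 1) q - 2 * W k p q)" for p q
  proof -
    \<comment> \<open>The factor \<open>k + 1\<close> is the sum of the three exponents \<open>k + 1 - p - q\<close>, \<open>p\<close> and \<open>q\<close>.\<close>
    have *: "real_of_int (int (Suc k) - p - q) * dpow (- 2 * t) (int (Suc k) - p - q) =
      - 2 * t * dpow (- 2 * t) (int k - p - q)"
      using dpow_rec[of "int (Suc k) - p - q" "- 2 * t"] by (simp add: algebra_simps)
    have "of_nat (Suc k) * W (Suc k) p q =
        (real_of_int (int (Suc k) - p - q) * dpow (- 2 * t) (int (Suc k) - p - q)) * dpow t p * dpow t q
        + dpow (- 2 * t) (int (Suc k) - p - q) * (of_int p * dpow t p) * dpow t q
        + dpow (- 2 * t) (int (Suc k) - p - q) * dpow t p * (of_int q * dpow t q)"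
      by (simp add: W_def algebra_simps)
    also have "\<dots> = t * (W k p (q - 1) + W k (p - 1) q - 2 * W k p q)"
      unfolding * dpow_rec by (simp add: W_def algebra_simps)
    finally show ?thesis .
  qed
  \<comment> \<open>The chosen column of the \<open>k\<close>-th power, read as a state on the lattice.  It vanishes at the
      leader's nodes because \<open>c\<close> and \<open>d\<close> are positive.\<close>
  define x where "x n m = fact k * W k (int n - int c) (int m - int d)" for n m
  have x0: "x i 0 = 0" "x 0 i = 0" for i
    using c d by (simp_all add: x_def W_def)
  have car: "?B ^\<^sub>m k \<in> carrier_mat (N * N) (N * N)"
    using L2_carrier[of N] by simp
  have j: "?j < N * N" using node_less c d by simp
  have i: "(n - 1) * N + (m - 1) < N * N" using node_less Suc.prems by simp
  have col: "col (?B ^\<^sub>m k) ?j = vec (N * N) (\<lambda>r. x (r div N + 1) (r mod N + 1))"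
  proof (rule eq_vecI)
    fix r assume "r < dim_vec (vec (N * N) (\<lambda>r. x (r div N + 1) (r mod N + 1)))"
    then have r: "r < N * N" by simp
    then have N: "r mod N < N" "r div N < N"
      using c by (simp_all add: less_mult_imp_div_less)
    have "(?B ^\<^sub>m k) $$ ((r div N + 1 - 1) * N + (r mod N + 1 - 1), ?j) = x (r div N + 1) (r mod N + 1)"
      using N unfolding x_def W_def by (intro Suc.IH) (simp_all add: Suc_le_eq)
    then show "col (?B ^\<^sub>m k) ?j $ r = vec (N * N) (\<lambda>r. x (r div N + 1) (r mod N + 1)) $ r"
      using r car j by simp
  qed (use car in simp)
  have "(?B ^\<^sub>m Suc k) $$ ((n - 1) * N + (m - 1), ?j) = (?B * ?B ^\<^sub>m k) $$ ((n - 1) * N + (m - 1), ?j)"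
    using L2_carrier[of N] by (subst pow_mat_Suc_left[of _ "N * N"]) simp_all
  also have "\<dots> = t * ((- L2 N *\<^sub>v col (?B ^\<^sub>m k) ?j) $ ((n - 1) * N + (m - 1)))"
    using L2_carrier[of N] car i j by simp
  also have "\<dots> = t * (- (x n m - x n (m - 1)) - (x n m - x (n - 1) m))"
    unfolding col using Suc.prems x0 by (subst L2_dynamics) simp_all
  also have "\<dots> = fact k * (t * (W k (int n - int c) (int m - int d - 1)
      + W k (int n - int c - 1) (int m - int d) - 2 * W k (int n - int c) (int m - int d)))"
    using Suc.prems by (simp add: x_def of_nat_diff algebra_simps)
  also have "\<dots> = fact (Suc k) * W (Suc k) (int n - int c) (int m - int d)"
    unfolding W_rec[symmetric] by (simp add: algebra_simps)
  finally show ?case unfolding W_def .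
qed

lemma mat_exp_L2_entry:
  fixes t :: real
  assumes nm: "1 \<le> n" "n \<le> N" "1 \<le> m" "m \<le> N" and c: "1 \<le> c" "c \<le> N" and d: "1 \<le> d" "d \<le> N"
  shows "mat_exp (t \<cdot>\<^sub>m (- L2 N)) $$ ((n - 1) * N + (m - 1), (c - 1) * N + (d - 1)) =
    exp (- 2 * t) * dpow t (int n - int c) * dpow t (int m - int d)"
proof -
  let ?p = "int n - int c" and ?q = "int m - int d"
  have "(\<lambda>k. dpow (- 2 * t) (int k - ?p - ?q) * dpow t ?p * dpow t ?q) sums
      (exp (- 2 * t) * dpow t ?p * dpow t ?q)"
  proof (cases "0 \<le> ?p \<and> 0 \<le> ?q")
    case True
    then have "(\<lambda>k. dpow (- 2 * t) (int k - (?p + ?q))) sums exp (- 2 * t)"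
      by (intro dpow_sums_exp) simp
    then show ?thesis
      by (intro sums_mult2) (simp add: algebra_simps)
  next
    case False
    then have "dpow t ?p = 0 \<or> dpow t ?q = 0" by (auto simp: not_le)
    then show ?thesis by auto
  qed
  moreover have "mat_exp (t \<cdot>\<^sub>m (- L2 N)) $$ ((n - 1) * N + (m - 1), (c - 1) * N + (d - 1)) =
      (\<Sum>k. dpow (- 2 * t) (int k - ?p - ?q) * dpow t ?p * dpow t ?q)"
  proof -
    have "mat_exp (t \<cdot>\<^sub>m (- L2 N)) $$ ((n - 1) * N + (m - 1), (c - 1) * N + (d - 1)) =
        (\<Sum>k. ((t \<cdot>\<^sub>m (- L2 N)) ^\<^sub>m k) $$ ((n - 1) * N + (m - 1), (c - 1) * N + (d - 1)) / fact k)"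
      using node_less[OF nm] node_less[OF c d] by (simp add: mat_exp_def)
    then show ?thesis
      unfolding pow_L2_entry[OF nm c d] by simp
  qed
  ultimately show ?thesis by (simp add: sums_iff)
qed

section \<open>The variance of a follower\<close>

lemma has_integral_power_times_exp:
  fixes a :: real
  assumes a: "0 < a"
  shows "((\<lambda>t. t ^ k * exp (- a * t)) has_integral fact k / a ^ Suc k) {0..}"
proof -
  \<comment> \<open>Up to normalisation, the integrand is the density of an Erlang distribution.\<close>
  have "(\<integral>\<^sup>+ t. ennreal (erlang_density k a t) \<partial>lborel) = ennreal 1"
    using nn_integral_erlang_ith_moment[OF a, of k 0] by simp
  then have "(erlang_density k a has_integral 1) UNIV"
    using a by (intro nn_integral_has_integral) simp_all
  then have "((\<lambda>t. fact k / a ^ Suc k * erlang_density k a t) has_integral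
      fact k / a ^ Suc k * 1) UNIV"
    by (rule has_integral_mult_right)
  also have "(\<lambda>t. fact k / a ^ Suc k * erlang_density k a t) =
      (\<lambda>t. if t \<in> {0..} then t ^ k * exp (- a * t) else 0)"
    using a by (auto simp: erlang_density_def fun_eq_iff)
  finally show ?thesis by (simp only: has_integral_restrict_UNIV mult_1_right)
qed

text \<open>The components of the stacked state vector, grouped by rows of the lattice.\<close>

lemma sum_nodes:
  "(\<Sum>r<N * N. f r) = (\<Sum>c = 1..N. \<Sum>d = 1..N. f ((c - 1) * N + (d - 1)))" for f :: "nat \<Rightarrow> real"
proof -
  have "(\<Sum>r<N * N. f r) = (\<Sum>u<N. \<Sum>v<N. f (u * N + v))"
    by (simp add: sum_mult_product add.commute)
  also have "\<dots> = (\<Sum>c = 1..N. \<Sum>d = 1..N. f ((c - 1) * N + (d - 1)))"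
    by (simp add: sum.atLeast1_atMost_eq)
  finally show ?thesis .
qed

lemma sum_reverse_truncate:
  fixes f :: "int \<Rightarrow> real"
  assumes "1 \<le> n" "n \<le> N" and zero: "\<And>p. p < 0 \<Longrightarrow> f p = 0"
  shows "(\<Sum>c = 1..N. f (int n - int c)) = (\<Sum>i = 1..n. f (int (i - 1)))"
proof -
  have "(\<Sum>c = 1..N. f (int n - int c)) = (\<Sum>c = 1..n. f (int n - int c))"
    using assms by (intro sum.mono_neutral_right) auto
  also have "\<dots> = (\<Sum>i = 1..n. f (int (i - 1)))"
    by (rule sum.reindex_bij_witness[of _ "\<lambda>i. n + 1 - i" "\<lambda>c. n + 1 - c"])
       (auto simp: of_nat_diff)
  finally show ?thesis .
qed

theorem lemma2:
  fixes N n m :: nat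
  assumes "N \<ge> 1" and "1 \<le> n" and "n \<le> N" and "1 \<le> m" and "m \<le> N"
  shows "diag_elem (diag_block N (steady_state_cov (L2 N)) n) m =
    (\<Sum>i = 1..n. \<Sum>j = 1..m.
       fact (2 * i + 2 * j - 4) /
       (4 * 4 ^ (2 * i + 2 * j - 4) * (fact (i - 1) * fact (j - 1))\<^sup>2))"
proof -
  let ?r = "(n - 1) * N + (m - 1)"
  let ?E = "\<lambda>t. mat_exp (t \<cdot>\<^sub>m (- L2 N))"
  have r: "?r < N * N" using assms by (intro node_less)
  have E: "?E t \<in> carrier_mat (N * N) (N * N)" for t
    using L2_carrier[of N] by (simp add: mat_exp_def)
  have tr: "mat_exp (t \<cdot>\<^sub>m (- transpose_mat (L2 N))) = transpose_mat (?E t)" for t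
  proof -
    have "t \<cdot>\<^sub>m (- transpose_mat (L2 N)) = transpose_mat (t \<cdot>\<^sub>m (- L2 N))"
      by (rule eq_matI) simp_all
    then show ?thesis using L2_carrier[of N] by (simp add: mat_exp_transpose[of _ "N * N"])
  qed
  have diag: "(?E t * mat_exp (t \<cdot>\<^sub>m (- transpose_mat (L2 N)))) $$ (?r, ?r) =
      (\<Sum>i = 1..n. \<Sum>j = 1..m.
        1 / (fact (i - 1) * fact (j - 1))\<^sup>2 * (t ^ (2 * i + 2 * j - 4) * exp (- 4 * t)))" for t
  proof -
    have "(?E t * mat_exp (t \<cdot>\<^sub>m (- transpose_mat (L2 N)))) $$ (?r, ?r) =
        (\<Sum>s<N * N. (?E t $$ (?r, s))\<^sup>2)"
      unfolding tr using r E[of t]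
      by (simp add: scalar_prod_def power2_eq_square atLeast0LessThan)
    also have "\<dots> = (\<Sum>c = 1..N. \<Sum>d = 1..N.
        (exp (- 2 * t) * dpow t (int n - int c) * dpow t (int m - int d))\<^sup>2)"
      unfolding sum_nodes using assms by (intro sum.cong refl, subst mat_exp_L2_entry) auto
    also have "\<dots> = (\<Sum>i = 1..n. \<Sum>j = 1..m.
        (exp (- 2 * t) * dpow t (int (i - 1)) * dpow t (int (j - 1)))\<^sup>2)"
      using sum_reverse_truncate[of m N "\<lambda>q. (exp (- 2 * t) * dpow t p * dpow t q)\<^sup>2" for p]
        sum_reverse_truncate[of n N "\<lambda>p. \<Sum>j = 1..m. (exp (- 2 * t) * dpow t p * dpow t (int (j - 1)))\<^sup>2"]
        assms by simp
    also have "\<dots> = (\<Sum>i = 1..n. \<Sum>j = 1..m.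
        1 / (fact (i - 1) * fact (j - 1))\<^sup>2 * (t ^ (2 * i + 2 * j - 4) * exp (- 4 * t)))"
    proof (intro sum.cong refl)
      fix i j assume "i \<in> {1..n}" "j \<in> {1..m}"
      then have "2 * i + 2 * j - 4 = 2 * (i - 1) + 2 * (j - 1)" by auto
      moreover have "exp (- 4 * t) = (exp (- 2 * t))\<^sup>2"
        by (simp add: power2_eq_square flip: exp_add)
      ultimately show "(exp (- 2 * t) * dpow t (int (i - 1)) * dpow t (int (j - 1)))\<^sup>2 =
          1 / (fact (i - 1) * fact (j - 1))\<^sup>2 * (t ^ (2 * i + 2 * j - 4) * exp (- 4 * t))"
        by (simp only: dpow_of_nat) (simp add: power_mult_distrib power_divide power_add power_mult power_commutes
            power2_eq_square)
    qed
    finally show ?thesis .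
  qed
  have "((\<lambda>t. (?E t * mat_exp (t \<cdot>\<^sub>m (- transpose_mat (L2 N)))) $$ (?r, ?r)) has_integral
      (\<Sum>i = 1..n. \<Sum>j = 1..m. 1 / (fact (i - 1) * fact (j - 1))\<^sup>2 *
        (fact (2 * i + 2 * j - 4) / 4 ^ Suc (2 * i + 2 * j - 4)))) {0..}"
    unfolding diag
    by (intro has_integral_sum has_integral_mult_right has_integral_power_times_exp) simp_all
  then have "integral {0..} (\<lambda>t. (?E t * mat_exp (t \<cdot>\<^sub>m (- transpose_mat (L2 N)))) $$ (?r, ?r)) =
      (\<Sum>i = 1..n. \<Sum>j = 1..m. 1 / (fact (i - 1) * fact (j - 1))\<^sup>2 *
        (fact (2 * i + 2 * j - 4) / 4 ^ Suc (2 * i + 2 * j - 4)))"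
    by (rule integral_unique)
  moreover have "diag_elem (diag_block N (steady_state_cov (L2 N)) n) m =
      integral {0..} (\<lambda>t. (?E t * mat_exp (t \<cdot>\<^sub>m (- transpose_mat (L2 N)))) $$ (?r, ?r))"
    using assms r L2_carrier[of N] by (simp add: diag_elem_def diag_block_def steady_state_cov_def)
  ultimately show ?thesis by (simp add: mult.commute)
qed

end
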